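(* There exist absolute constants $c>0$ and $C,C_1\ge1$ such that the following holds. Let $C_1\le d\le n/24$ and let natural numbers $\ell$ and $r$ satisfy $$\frac n4\ge r\ge\ell\ge\frac{Cn\ln(en/r)}{d}.$$ Then $$\mathbb{P}\left\{\bigcup\mathcal{D}^0(I,J)\right\}\le\exp\left(-\frac{cr\ell d}{n}\right),$$ where the union is taken over all $I,J\subset[n]$ with $|I|\ge\ell$ and $|J|\ge r$.
   Context: $[n]=\{1,\dots,n\}$; $n,d$ are positive integers. $\mathcal{D}=\mathcal{D}_{n,d}$ is the set of all $d$-regular directed graphs on the labeled vertex set $[n]$: every vertex has exactly $d$ in-neighbors and $d$ out-neighbors; loops and anti-parallel edges are allowed, multiple edges are not. $\mathbb{P}$ is the normalized counting measure on $\mathcal{D}$. For $I,J\subset[n]$, $\mathcal{D}^0(I,J)$ is the set of all $G\in\mathcal{D}$ having no edge $(i,j)$ (from $i$ to $j$) with $i\in I$ and $j\in J$. Absolute constants are independent of all parameters; $e$ is the base of the natural logarithm. *)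

theory Defs
  imports "HOL-Probability.Probability" "Graph_Theory.Pair_Digraph"
begin

text \<open>
  Arcs of a \<^typ>\<open>'a pair_pre_digraph\<close> are ordered pairs of vertices, so multiple edges are
  excluded, whereas loops and anti-parallel edges are allowed. The arc \<open>(i, j)\<close> goes
  from \<open>i\<close> to \<open>j\<close>.
\<close>

definition regular_digraphs :: "nat \<Rightarrow> nat \<Rightarrow> nat pair_pre_digraph set" where
  "regular_digraphs n d =
     {G. pair_fin_digraph G \<and> pverts G = {1..n} \<and>
         (\<forall>v\<in>{1..n}. in_degree (with_proj G) v = d \<and> out_degree (with_proj G) v = d)}"

definition no_edge_digraphs :: "nat \<Rightarrow> nat \<Rightarrow> nat set \<Rightarrow> nat set \<Rightarrow> nat pair_pre_digraph set" where
  "no_edge_digraphs n d I J =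
     {G \<in> regular_digraphs n d. \<forall>i\<in>I. \<forall>j\<in>J. (i, j) \<notin> parcs G}"

end

theory Submission
  imports Defs
begin

text \<open>
  Fix \<open>I\<close> and \<open>J\<close> of sizes \<open>l\<close> and \<open>r\<close>, put \<open>\<mu> = l r d / n\<close>, and let \<open>N k\<close> be the number of
  \<open>d\<close>-regular digraphs with exactly \<open>k\<close> arcs from \<open>I\<close> to \<open>J\<close>. Replacing three arcs
  \<open>(i, j')\<close>, \<open>(i', j)\<close>, \<open>(a, b)\<close> by \<open>(i, j)\<close>, \<open>(i', b)\<close>, \<open>(a, j')\<close>, where among
  the indices only \<open>i\<close> lies in \<open>I\<close> and only \<open>j\<close> lies in \<open>J\<close>, creates one more arc from
  \<open>I\<close> to \<open>J\<close>. The usual exchange of two arcs does not suffice: when \<open>r < d\<close>, the arcs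
  \<open>(i', j')\<close> may all be present already. The free arc \<open>(a, b)\<close> removes this obstruction
  because \<open>d\<^sup>2\<close> is small compared with \<open>n d\<close>. Double counting gives
  \<open>\<mu> / 6 * N k \<le> (k + 1) * N (k + 1)\<close> for \<open>k \<le> \<mu>\<close>, so \<open>N\<close> grows by a factor of at least
  \<open>3\<close> as long as \<open>k + 1 \<le> \<mu> / 18\<close>, and \<open>N 0\<close> is exponentially small in \<open>\<mu>\<close>. The lower
  bound on \<open>l\<close> makes \<open>\<mu>\<close> large compared with \<open>r ln (e n / r)\<close>, which pays for the union
  bound over \<open>I\<close> and \<open>J\<close>.
\<close>

section \<open>Regular relations and their arc counts\<close>

text \<open>Digraphs are represented by their arc sets alone, so that neighbourhoods become
  relational images and reversing all arcs is \<open>converse\<close>. \<open>bij_betw_parcs\<close>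
  makes the link to \<open>regular_digraphs\<close>.\<close>

definition biregular :: "'a set \<Rightarrow> nat \<Rightarrow> 'a rel set" where
  "biregular V d =
     {E. E \<subseteq> V \<times> V \<and> (\<forall>v\<in>V. card (E `` {v}) = d \<and> card (E\<inverse> `` {v}) = d)}"

lemma finite_biregular: "finite V \<Longrightarrow> finite (biregular V d)"
  by (rule finite_subset[of _ "Pow (V \<times> V)"]) (auto simp: biregular_def)

lemma biregular_finite: "finite V \<Longrightarrow> E \<in> biregular V d \<Longrightarrow> finite E"
  by (auto simp: biregular_def intro: finite_subset[of _ "V \<times> V"])

lemma biregular_converse: "E \<in> biregular V d \<Longrightarrow> E\<inverse> \<in> biregular V d"
  by (auto simp: biregular_def)

lemma card_biregular_rows:
  assumes "finite V" "E \<in> biregular V d" "I \<subseteq> V"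
  shows "card (E \<inter> I \<times> UNIV) = card I * d"
proof -
  have "E \<inter> I \<times> UNIV = (SIGMA i:I. E `` {i})" by auto
  moreover have "card (SIGMA i:I. E `` {i}) = (\<Sum>i\<in>I. card (E `` {i}))"
    using assms biregular_finite[OF assms(1,2)]
    by (intro card_SigmaI) (auto intro: finite_subset finite_Image)
  moreover have "\<dots> = (\<Sum>i\<in>I. d)"
    using assms by (intro sum.cong) (auto simp: biregular_def)
  ultimately show ?thesis by simp
qed

lemma card_biregular_cols:
  assumes "finite V" "E \<in> biregular V d" "J \<subseteq> V"
  shows "card (E \<inter> UNIV \<times> J) = card J * d"
proof -
  have "E\<inverse> \<inter> J \<times> UNIV = (E \<inter> UNIV \<times> J)\<inverse>" by auto
  then show ?thesis
    using card_biregular_rows[OF assms(1) biregular_converse[OF assms(2)] assms(3)]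
    by (simp add: card_inverse)
qed

lemma card_biregular:
  assumes "finite V" "E \<in> biregular V d"
  shows "card E = card V * d"
proof -
  have "E \<inter> V \<times> UNIV = E" using assms by (auto simp: biregular_def)
  then show ?thesis using card_biregular_rows[OF assms, of V] by simp
qed

lemma biregular_finite_Image:
  assumes "finite V" "E \<in> biregular V d"
  shows "finite (E `` {v})" "finite (E\<inverse> `` {v})"
  using biregular_finite[OF assms] by (auto intro: finite_Image)

text \<open>Vertices outside \<open>V\<close> have no neighbours, so the bound needs no membership
  condition on \<open>v\<close>. This keeps the estimates of the bad triples below free of side
  conditions.\<close>

lemma card_biregular_Image_le:
  assumes "E \<in> biregular V d"
  shows "card (E `` {v}) \<le> d" "card (E\<inverse> `` {v}) \<le> d"
proof -
  have "v \<notin> V \<Longrightarrow> E `` {v} = {}" "v \<notin> V \<Longrightarrow> E\<inverse> `` {v} = {}"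
    using assms by (auto simp: biregular_def)
  then show "card (E `` {v}) \<le> d" "card (E\<inverse> `` {v}) \<le> d"
    using assms by (cases "v \<in> V"; auto simp: biregular_def)+
qed

section \<open>The exchange of three arcs\<close>

text \<open>Each of the three sources trades one present target for an absent one, and the sources
  being distinct keeps the trades from interfering. Applied to \<open>E\<close> this controls
  out-degrees, applied to the converse it controls in-degrees.\<close>

lemma card_Image_switch:
  assumes "finite E" "distinct [x1, x2, x3]"
    and "(x1, y1) \<in> E" "(x2, y2) \<in> E" "(x3, y3) \<in> E"
    and "(x1, z1) \<notin> E" "(x2, z2) \<notin> E" "(x3, z3) \<notin> E"
  shows "card ((E - {(x1, y1), (x2, y2), (x3, y3)} \<union> {(x1, z1), (x2, z2), (x3, z3)}) `` {v})
    = card (E `` {v})" (is "card (?E' `` {v}) = _")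
proof -
  have fin: "finite (E `` {v})" using assms(1) by (auto intro: finite_Image)
  have swap: "card (insert z (A - {y})) = card A" if "finite A" "y \<in> A" "z \<notin> A" for y z :: 'b and A
    using that by (metis Diff_iff card.insert card.remove finite_Diff)
  consider "v = x1" | "v = x2" | "v = x3" | "v \<notin> {x1, x2, x3}" by blast
  then show ?thesis
  proof cases
    case 1
    then have "?E' `` {v} = insert z1 (E `` {v} - {y1})" using assms by auto
    then show ?thesis using swap[OF fin, of y1 z1] assms 1 by auto
  next
    case 2
    then have "?E' `` {v} = insert z2 (E `` {v} - {y2})" using assms by auto
    then show ?thesis using swap[OF fin, of y2 z2] assms 2 by auto
  next
    case 3
    then have "?E' `` {v} = insert z3 (E `` {v} - {y3})" using assms by auto
    then show ?thesis using swap[OF fin, of y3 z3] assms 3 by auto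
  next
    case 4
    then have "?E' `` {v} = E `` {v}" by auto
    then show ?thesis by simp
  qed
qed

text \<open>The tails \<open>i\<close>, \<open>i'\<close>, \<open>a\<close> stay in place while the
  heads \<open>j'\<close>, \<open>j\<close>, \<open>b\<close> are permuted cyclically among
  them.\<close>

definition switch :: "'a rel \<Rightarrow> ('a \<times> 'a) \<times> ('a \<times> 'a) \<times> ('a \<times> 'a) \<Rightarrow> 'a rel" where
  "switch E = (\<lambda>((i, j'), (i', j), (a, b)).
     E - {(i, j'), (i', j), (a, b)} \<union> {(i, j), (i', b), (a, j')})"

definition switchings ::
  "'a set \<Rightarrow> 'a set \<Rightarrow> 'a rel \<Rightarrow> (('a \<times> 'a) \<times> ('a \<times> 'a) \<times> ('a \<times> 'a)) set" where
  "switchings I J E = {((i, j'), (i', j), (a, b)).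
     (i, j') \<in> E \<inter> I \<times> (- J) \<and> (i', j) \<in> E \<inter> (- I) \<times> J \<and> (a, b) \<in> E \<inter> (- I) \<times> (- J) \<and>
     (i, j) \<notin> E \<and> (i', b) \<notin> E \<and> (a, j') \<notin> E}"

lemma switch_biregular:
  assumes "finite V" "E \<in> biregular V d" "t \<in> switchings I J E"
  shows "switch E t \<in> biregular V d"
proof -
  obtain i j' i' j a b where t: "t = ((i, j'), (i', j), (a, b))" by (metis prod.collapse)
  have old: "(i, j') \<in> E" "(i', j) \<in> E" "(a, b) \<in> E"
    and new: "(i, j) \<notin> E" "(i', b) \<notin> E" "(a, j') \<notin> E"
    and ms: "i \<in> I" "j' \<notin> J" "i' \<notin> I" "j \<in> J" "a \<notin> I" "b \<notin> J"
    using assms(3) unfolding switchings_def t by auto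
  \<comment> \<open>Membership in \<open>I\<close> and \<open>J\<close> separates \<open>i\<close>
    from \<open>i'\<close>, \<open>a\<close> and \<open>j\<close> from \<open>j'\<close>,
    \<open>b\<close>. If \<open>i' = a\<close>, then \<open>(i', b)\<close> would be the present arc
    \<open>(a, b)\<close>; if \<open>j' = b\<close>, then \<open>(a, j')\<close> would be.\<close>
  have dist: "distinct [i, i', a]" "distinct [j', j, b]"
    using old new ms by auto
  have conv: "(switch E t)\<inverse> = E\<inverse> - {(j', i), (j, i'), (b, a)} \<union> {(j', a), (j, i), (b, i')}"
    unfolding switch_def t by auto
  have fin: "finite E" "finite (E\<inverse>)" using biregular_finite[OF assms(1,2)] by auto
  have "card (switch E t `` {v}) = card (E `` {v})" for v
    using card_Image_switch[OF fin(1) dist(1) old new] unfolding switch_def t by simp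
  moreover have "card ((switch E t)\<inverse> `` {v}) = card (E\<inverse> `` {v})" for v
    unfolding conv using fin(2) dist(2) old new by (intro card_Image_switch) auto
  moreover have "switch E t \<subseteq> V \<times> V"
    using assms(2) old unfolding switch_def t biregular_def by auto
  ultimately show ?thesis using assms(2) unfolding biregular_def by simp
qed

text \<open>None of the removed arcs lies in \<open>I \<times> J\<close>, and of the added ones only
  \<open>(i, j)\<close> does.\<close>

lemma card_switch:
  assumes "finite E" "t \<in> switchings I J E"
  shows "card (switch E t \<inter> I \<times> J) = Suc (card (E \<inter> I \<times> J))"
proof -
  obtain i j' i' j a b where t: "t = ((i, j'), (i', j), (a, b))" by (metis prod.collapse)
  have "switch E t \<inter> I \<times> J = insert (i, j) (E \<inter> I \<times> J)" "(i, j) \<notin> E"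
    using assms(2) unfolding switchings_def switch_def t by auto
  then show ?thesis using assms(1) by simp
qed

text \<open>Recording the three new arcs makes the exchange reversible: the removed arcs were
  present and the added ones absent, so undoing it restores \<open>E\<close>. Hence a relation is
  reached at most as often as such triples can be chosen among its arcs.\<close>

lemma inj_on_switch:
  "inj_on (\<lambda>(E, (i, j'), (i', j), (a, b)). (switch E ((i, j'), (i', j), (a, b)), (i, j), (i', b), (a, j')))
     (SIGMA E:A. switchings I J E)"
proof (rule inj_on_inverseI[where g = "\<lambda>(E', (i, j), (i', b), (a, j')).
    (E' - {(i, j), (i', b), (a, j')} \<union> {(i, j'), (i', j), (a, b)}, (i, j'), (i', j), (a, b))"])
qed (auto simp: switchings_def switch_def)

section \<open>Double counting of switchings\<close>

text \<open>From all triples in \<open>A \<times> B \<times> D\<close> those are subtracted for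
  which a replacement arc is already present. The bound on \<open>k\<close> serves twice: it keeps
  \<open>A\<close> and \<open>B\<close> large, and it limits the collisions at
  \<open>(i, j)\<close>.\<close>

lemma card_switchings_ge:
  assumes V: "finite V" "card V = n" and E: "E \<in> biregular V d" and IJ: "I \<subseteq> V" "J \<subseteq> V"
    and card: "card I = l" "card J = r" and k: "card (E \<inter> I \<times> J) = k"
    and dn: "24 * d \<le> n" and rn: "4 * r \<le> n" and lr: "l \<le> r" and n: "n > 0"
    and k_le: "real k \<le> real l * real r * real d / real n"
  shows "real (card (switchings I J E)) \<ge> real l * real r * real n * real d ^ 3 / 6"
proof -
  define A where "A = E \<inter> I \<times> (- J)"
  define B where "B = E \<inter> (- I) \<times> J"
  define D where "D = E \<inter> (- I) \<times> (- J)"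
  have finE: "finite E" by (rule biregular_finite[OF V(1) E])
  have fin: "finite A" "finite B" "finite D" unfolding A_def B_def D_def using finE by auto
  have Un: "E \<inter> I \<times> UNIV = A \<union> (E \<inter> I \<times> J)" "E \<inter> UNIV \<times> J = B \<union> (E \<inter> I \<times> J)"
    and Un3: "E = (A \<union> (E \<inter> UNIV \<times> J)) \<union> D"
    unfolding A_def B_def D_def by auto
  have "card (E \<inter> I \<times> UNIV) = card A + k"
    unfolding Un k[symmetric] using finE fin by (intro card_Un_disjoint) (auto simp: A_def)
  then have cA: "card A + k = l * d" using card_biregular_rows[OF V(1) E IJ(1)] card by simp
  have "card (E \<inter> UNIV \<times> J) = card B + k"
    unfolding Un k[symmetric] using finE fin by (intro card_Un_disjoint) (auto simp: B_def)
  then have cB: "card B + k = r * d" using card_biregular_cols[OF V(1) E IJ(2)] card by simp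
  have cE: "card E = n * d" using card_biregular[OF V(1) E] V(2) by simp
  have "card E \<le> card (A \<union> (E \<inter> UNIV \<times> J)) + card D"
    using card_Un_le[of "A \<union> (E \<inter> UNIV \<times> J)" D] Un3 by simp
  also have "\<dots> \<le> card A + card (E \<inter> UNIV \<times> J) + card D"
    using card_Un_le[of A "E \<inter> UNIV \<times> J"] by simp
  finally have cD: "n * d \<le> l * d + r * d + card D"
    using cE cA cB \<open>card (E \<inter> UNIV \<times> J) = card B + k\<close> by linarith
  note fI = biregular_finite_Image[OF V(1) E] and cI = card_biregular_Image_le[OF E]
  \<comment> \<open>Each set encodes one kind of failure, starting from what is fixed and then
    choosing neighbours along present arcs, which costs a factor of at most \<open>d\<close> per
    choice. Block conditions on the chosen neighbours are dropped, as only upper bounds are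
    needed.\<close>
  define S1 where "S1 = (SIGMA x:E \<inter> I \<times> J. E `` {fst x} \<times> E\<inverse> `` {snd x} \<times> E)"
  define S2 where "S2 = (SIGMA x:A \<times> B. SIGMA b:E `` {fst (snd x)}. E\<inverse> `` {b})"
  define S3 where "S3 = (SIGMA x:A \<times> B. SIGMA a:E\<inverse> `` {snd (fst x)}. E `` {a})"
  have finS: "finite S1" "finite S2" "finite S3"
    unfolding S1_def S2_def S3_def using finE fin fI by (auto intro!: finite_SigmaI)
  \<comment> \<open>A triple of arcs that is not a switching fails because of a present arc \<open>(i, j)\<close>,
    \<open>(i', b)\<close> or \<open>(a, j')\<close>, respectively.\<close>
  have "A \<times> B \<times> D \<subseteq> switchings I J E
      \<union> (\<lambda>(x, j', i', e). ((fst x, j'), (i', snd x), e)) ` S1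
      \<union> (\<lambda>((x, y), b, a). (x, y, (a, b))) ` S2
      \<union> (\<lambda>((x, y), a, b). (x, y, (a, b))) ` S3" (is "_ \<subseteq> _ \<union> ?T1 \<union> ?T2 \<union> ?T3")
  proof (clarify)
    fix i j' i' j a b
    assume h: "(i, j') \<in> A" "(i', j) \<in> B" "(a, b) \<in> D"
      and n3: "((i, j'), (i', j), a, b) \<notin> ?T3" and n2: "((i, j'), (i', j), a, b) \<notin> ?T2"
      and n1: "((i, j'), (i', j), a, b) \<notin> ?T1"
    have "(i, j) \<notin> E"
    proof
      assume "(i, j) \<in> E"
      then have "((i, j), j', i', (a, b)) \<in> S1"
        using h unfolding S1_def A_def B_def D_def by auto
      then show False using n1 by force
    qed
    moreover have "(i', b) \<notin> E"
    proof
      assume "(i', b) \<in> E"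
      then have "(((i, j'), (i', j)), b, a) \<in> S2"
        using h unfolding S2_def D_def by auto
      then show False using n2 by force
    qed
    moreover have "(a, j') \<notin> E"
    proof
      assume "(a, j') \<in> E"
      then have "(((i, j'), (i', j)), a, b) \<in> S3"
        using h unfolding S3_def D_def by auto
      then show False using n3 by force
    qed
    ultimately show "((i, j'), (i', j), a, b) \<in> switchings I J E"
      using h unfolding switchings_def A_def B_def D_def by auto
  qed
  moreover have "finite (switchings I J E)"
    by (rule finite_subset[of _ "E \<times> E \<times> E"]) (use finE in \<open>auto simp: switchings_def\<close>)
  ultimately have "card (A \<times> B \<times> D) \<le> card (switchings I J E \<union> ?T1 \<union> ?T2 \<union> ?T3)"
    using finS by (intro card_mono) auto
  also have "\<dots> \<le> card (switchings I J E) + card ?T1 + card ?T2 + card ?T3"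
    by (meson add_mono card_Un_le le_refl order_trans)
  also have "\<dots> \<le> card (switchings I J E) + card S1 + card S2 + card S3"
    using finS by (intro add_mono card_image_le) auto
  also have "card S1 \<le> k * (d * (d * (n * d)))"
  proof -
    have "card S1 = (\<Sum>x\<in>E \<inter> I \<times> J. card (E `` {fst x} \<times> E\<inverse> `` {snd x} \<times> E))"
      unfolding S1_def using finE fI by (intro card_SigmaI) auto
    also have "\<dots> \<le> (\<Sum>x\<in>E \<inter> I \<times> J. d * (d * (n * d)))"
      unfolding card_cartesian_product cE by (intro sum_mono mult_mono cI) auto
    finally show ?thesis using k by simp
  qed
  also have "card S2 \<le> card A * card B * (d * d)"
  proof -
    have "card S2 = (\<Sum>x\<in>A \<times> B. card (SIGMA b:E `` {fst (snd x)}. E\<inverse> `` {b}))"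
      unfolding S2_def using fin fI by (intro card_SigmaI) auto
    also have "\<dots> \<le> (\<Sum>x\<in>A \<times> B. d * d)"
    proof (rule sum_mono)
      fix x
      have "card (SIGMA b:E `` {fst (snd x)}. E\<inverse> `` {b}) = (\<Sum>b\<in>E `` {fst (snd x)}. card (E\<inverse> `` {b}))"
        using fI by (intro card_SigmaI) auto
      also have "\<dots> \<le> card (E `` {fst (snd x)}) * d"
        using sum_bounded_above[of "E `` {fst (snd x)}" "\<lambda>b. card (E\<inverse> `` {b})" d] cI(2) by simp
      also have "\<dots> \<le> d * d" using cI(1) by (rule mult_right_mono) simp
      finally show "card (SIGMA b:E `` {fst (snd x)}. E\<inverse> `` {b}) \<le> d * d" .
    qed
    finally show ?thesis by (simp add: card_cartesian_product)
  qed
  also have "card S3 \<le> card A * card B * (d * d)"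
  proof -
    have "card S3 = (\<Sum>x\<in>A \<times> B. card (SIGMA a:E\<inverse> `` {snd (fst x)}. E `` {a}))"
      unfolding S3_def using fin fI by (intro card_SigmaI) auto
    also have "\<dots> \<le> (\<Sum>x\<in>A \<times> B. d * d)"
    proof (rule sum_mono)
      fix x
      have "card (SIGMA a:E\<inverse> `` {snd (fst x)}. E `` {a}) = (\<Sum>a\<in>E\<inverse> `` {snd (fst x)}. card (E `` {a}))"
        using fI by (intro card_SigmaI) auto
      also have "\<dots> \<le> card (E\<inverse> `` {snd (fst x)}) * d"
        using sum_bounded_above[of "E\<inverse> `` {snd (fst x)}" "\<lambda>a. card (E `` {a})" d] cI(1) by simp
      also have "\<dots> \<le> d * d" using cI(2) by (rule mult_right_mono) simp
      finally show "card (SIGMA a:E\<inverse> `` {snd (fst x)}. E `` {a}) \<le> d * d" .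
    qed
    finally show ?thesis by (simp add: card_cartesian_product)
  qed
  finally have "card A * card B * card D \<le> card (switchings I J E) + k * (d * (d * (n * d)))
      + card A * card B * (d * d) + card A * card B * (d * d)"
    by (simp add: card_cartesian_product algebra_simps)
  \<comment> \<open>The losses from \<open>S2\<close> and \<open>S3\<close> are both charged to the
    choice of the arc in \<open>D\<close>, whence the factor
    \<open>card D - 2 * d^2\<close>.\<close>
  then have main: "real (card A) * real (card B) * (real (card D) - 2 * real d ^ 2)
      \<le> real (card (switchings I J E)) + real k * (real d ^ 3 * real n)"
    unfolding of_nat_le_iff[where 'a = real, symmetric]
    by (simp add: algebra_simps power2_eq_square power3_eq_cube)
  have d24: "real d \<le> real n / 24" and r4: "real r \<le> real n / 4" and l4: "real l \<le> real n / 4"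
    using dn rn lr by linarith+
  have n0: "real n > 0" using n by simp
  \<comment> \<open>Since \<open>r \<le> n / 4\<close>, at most a quarter of the arcs leaving
    \<open>I\<close> end in \<open>J\<close>; symmetrically for the arcs entering \<open>J\<close>.
    This gives the factors \<open>3 / 4\<close> for \<open>A\<close> and \<open>B\<close>.\<close>
  have kl: "real k \<le> real l * real d / 4"
  proof -
    have "real l * real r * real d / real n = real l * real d * (real r / real n)" by simp
    also have "\<dots> \<le> real l * real d * (1 / 4)"
      using r4 n0 by (intro mult_left_mono) (auto simp: field_simps)
    finally show ?thesis using k_le by linarith
  qed
  have kr: "real k \<le> real r * real d / 4"
  proof -
    have "real l * real r * real d / real n = real r * real d * (real l / real n)" by simp
    also have "\<dots> \<le> real r * real d * (1 / 4)"
      using l4 n0 by (intro mult_left_mono) (auto simp: field_simps)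
    finally show ?thesis using k_le by linarith
  qed
  have rA: "real (card A) \<ge> 3 / 4 * (real l * real d)"
    using kl cA[THEN arg_cong[where f = real]] by simp
  have rB: "real (card B) \<ge> 3 / 4 * (real r * real d)"
    using kr cB[THEN arg_cong[where f = real]] by simp
  \<comment> \<open>The constant is \<open>1 - 1/4 - 1/4 - 2/24 = 5/12\<close>; here
    \<open>d \<le> n / 24\<close> makes the \<open>d^2\<close> collisions affordable.\<close>
  have rD: "real (card D) - 2 * real d ^ 2 \<ge> 5 / 12 * (real n * real d)"
  proof -
    have "real n * real d \<le> real l * real d + real r * real d + real (card D)"
      using cD unfolding of_nat_le_iff[where 'a = real, symmetric] by simp
    moreover have "real l * real d \<le> real n / 4 * real d" "real r * real d \<le> real n / 4 * real d"
      by (intro mult_right_mono l4 r4; simp)+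
    moreover have "real d ^ 2 \<le> real n / 24 * real d"
      unfolding power2_eq_square using d24 by (intro mult_right_mono) auto
    ultimately show ?thesis by (simp add: field_simps)
  qed
  have "3 / 4 * (real l * real d) * (3 / 4 * (real r * real d)) * (5 / 12 * (real n * real d))
      \<le> real (card A) * real (card B) * (real (card D) - 2 * real d ^ 2)"
    using rA rB rD by (intro mult_mono) auto
  moreover have "real k * (real d ^ 3 * real n) \<le> real l * real r * real n * real d ^ 3 / 24"
  proof -
    have "real k * real n \<le> real l * real r * real d"
      using k_le n0 by (simp add: field_simps)
    also have "\<dots> \<le> real l * real r * (real n / 24)"
      using d24 by (intro mult_left_mono) auto
    finally have "real k * real n * real d ^ 3 \<le> real l * real r * (real n / 24) * real d ^ 3"
      by (intro mult_right_mono) auto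
    then show ?thesis by (simp add: algebra_simps)
  qed
  moreover have "real l * real r * real n * real d ^ 3 \<ge> 0" by simp
  \<comment> \<open>The constants leave room: \<open>9/16 * 5/12 - 1/24 = 37/192\<close>, which
    exceeds \<open>1/6\<close>.\<close>
  ultimately show ?thesis
    using main by (simp add: power3_eq_cube algebra_simps)
qed

text \<open>Pairs of a relation and a switching are counted from both ends. A relation with
  \<open>k + 1\<close> arcs in \<open>I \<times> J\<close> is reached at most
  \<open>(k + 1) * (n * d)^2\<close> times: the new arc \<open>(i, j)\<close> is one of those
  \<open>k + 1\<close>, the other two new arcs are arbitrary. Dividing the lower bound of
  \<open>card_switchings_ge\<close> by \<open>(n * d)^2\<close> gives the factor on the
  left.\<close>

lemma switching_ratio:
  fixes V :: "'a set"
  defines "N \<equiv> (\<lambda>I J d k. {E \<in> biregular V d. card (E \<inter> I \<times> J) = k})"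
  assumes V: "finite V" "card V = n" and IJ: "I \<subseteq> V" "J \<subseteq> V"
    and card: "card I = l" "card J = r"
    and dn: "24 * d \<le> n" and rn: "4 * r \<le> n" and lr: "l \<le> r" and n: "n > 0" and d: "d > 0"
    and k_le: "real k \<le> real l * real r * real d / real n"
  shows "real l * real r * real d / real n / 6 * real (card (N I J d k))
    \<le> real (Suc k) * real (card (N I J d (Suc k)))"
proof -
  let ?X = "N I J d k" and ?Y = "N I J d (Suc k)"
  have finN: "finite (N I J d k)" for k unfolding N_def using finite_biregular[OF V(1), of d] by simp
  have finE: "finite E" if "E \<in> N I J d k" for E k
    using that biregular_finite[OF V(1)] unfolding N_def by auto
  have finS: "finite (switchings I J E)" if "E \<in> ?X" for E
    by (rule finite_subset[of _ "E \<times> E \<times> E"]) (use finE[OF that] in \<open>auto simp: switchings_def\<close>)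
  let ?f = "\<lambda>(E, (i, j'), (i', j), (a, b)). (switch E ((i, j'), (i', j), (a, b)), (i, j), (i', b), (a, j'))"
  have "?f ` (SIGMA E:?X. switchings I J E) \<subseteq> (SIGMA E:?Y. (E \<inter> I \<times> J) \<times> E \<times> E)"
  proof (clarify, intro conjI)
    fix E i j' i' j a b
    assume EX: "E \<in> ?X" and t: "((i, j'), (i', j), (a, b)) \<in> switchings I J E"
    show "switch E ((i, j'), (i', j), (a, b)) \<in> ?Y"
      using switch_biregular[OF V(1) _ t] card_switch[OF finE[OF EX] t] EX unfolding N_def by auto
  qed (auto simp: switch_def switchings_def)
  then have "card (SIGMA E:?X. switchings I J E) \<le> card (SIGMA E:?Y. (E \<inter> I \<times> J) \<times> E \<times> E)"
    using finN finE by (intro card_inj_on_le[OF inj_on_switch]) (auto intro!: finite_SigmaI)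
  also have "\<dots> = (\<Sum>E\<in>?Y. card ((E \<inter> I \<times> J) \<times> E \<times> E))"
    using finN finE by (intro card_SigmaI) auto
  also have "\<dots> = (\<Sum>E\<in>?Y. Suc k * ((n * d) * (n * d)))"
    using card_biregular[OF V(1)] V(2) by (intro sum.cong) (auto simp: card_cartesian_product N_def)
  finally have up: "card (SIGMA E:?X. switchings I J E) \<le> card ?Y * (Suc k * ((n * d) * (n * d)))"
    by simp
  have "card ?X * (real l * real r * real n * real d ^ 3 / 6) \<le> (\<Sum>E\<in>?X. real (card (switchings I J E)))"
    using card_switchings_ge[OF V _ IJ card _ dn rn lr n k_le]
    by (intro sum_bounded_below) (auto simp: N_def)
  also have "\<dots> = real (card (SIGMA E:?X. switchings I J E))"
    using finN finS by (subst card_SigmaI) auto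
  also have "\<dots> \<le> real (card ?Y * (Suc k * ((n * d) * (n * d))))"
    using up by (simp only: of_nat_le_iff)
  finally have "real (card ?X) * (real l * real r * real n * real d ^ 3 / 6)
      \<le> real (card ?Y) * (real (Suc k) * ((real n * real d) * (real n * real d)))"
    by (simp only: of_nat_mult)
  moreover have "real (card ?X) * (real l * real r * real n * real d ^ 3 / 6) =
      (real l * real r * real d / real n / 6 * real (card ?X)) * ((real n * real d) * (real n * real d))"
    using n by (simp add: field_simps power3_eq_cube)
  ultimately have "(real l * real r * real d / real n / 6 * real (card ?X)) * ((real n * real d) * (real n * real d))
      \<le> (real (Suc k) * real (card ?Y)) * ((real n * real d) * (real n * real d))"
    by (simp only: mult_ac)
  then show ?thesis using n d by (simp only: mult_le_cancel_right) simp
qed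

section \<open>Exponential decay for fixed vertex sets\<close>

text \<open>The ratio estimate is iterated \<open>K = \<lfloor>\<mu> / 18\<rfloor>\<close> times
  from \<open>k = 0\<close>, gaining a factor \<open>e\<close> each time; the summand
  \<open>1\<close> in the exponent pays for rounding down.\<close>

lemma card_biregular_no_edge_le:
  fixes V :: "'a set"
  assumes V: "finite V" "card V = n" and IJ: "I \<subseteq> V" "J \<subseteq> V"
    and card: "card I = l" "card J = r"
    and dn: "24 * d \<le> n" and rn: "4 * r \<le> n" and lr: "l \<le> r" and n: "n > 0" and d: "d > 0"
  defines "\<mu> \<equiv> real l * real r * real d / real n"
  shows "real (card {E \<in> biregular V d. E \<inter> I \<times> J = {}})
    \<le> exp (1 - \<mu> / 18) * real (card (biregular V d))"
proof -
  define N where "N k = card {E \<in> biregular V d. card (E \<inter> I \<times> J) = k}" for k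
  define K where "K = nat \<lfloor>\<mu> / 18\<rfloor>"
  have mu0: "\<mu> \<ge> 0" unfolding \<mu>_def by simp
  have K: "real K \<le> \<mu> / 18" "\<mu> / 18 - 1 \<le> real K"
    unfolding K_def using mu0 by linarith+
  have step: "real (N k) \<le> exp (-1) * real (N (Suc k))" if "Suc k \<le> K" for k
  proof -
    have k: "real (Suc k) \<le> \<mu> / 18" using that K(1) by linarith
    then have "real k \<le> \<mu>" using mu0 by simp
    then have "\<mu> / 6 * real (N k) \<le> real (Suc k) * real (N (Suc k))"
      unfolding N_def \<mu>_def
      by (intro switching_ratio[OF V IJ card dn rn lr n d])
    also have "\<dots> \<le> \<mu> / 18 * real (N (Suc k))"
      using k by (intro mult_right_mono) auto
    finally have "\<mu> * (3 * real (N k)) \<le> \<mu> * real (N (Suc k))" by simp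
    moreover have "\<mu> > 0" using k by simp
    ultimately have "3 * real (N k) \<le> real (N (Suc k))" by (simp only: mult_le_cancel_left_pos)
    \<comment> \<open>The factor \<open>3\<close> is weakened to \<open>e\<close>, so that the
      iteration yields a pure exponential.\<close>
    moreover have "exp 1 * real (N k) \<le> 3 * real (N k)"
      using exp_le by (intro mult_right_mono) auto
    ultimately show ?thesis by (simp add: exp_minus field_simps)
  qed
  have iter: "real (N 0) \<le> exp (- real k) * real (N k)" if "k \<le> K" for k
    using that
  proof (induction k)
    case 0
    then show ?case by simp
  next
    case (Suc k)
    then have "real (N 0) \<le> exp (- real k) * real (N k)" by simp
    also have "\<dots> \<le> exp (- real k) * (exp (-1) * real (N (Suc k)))"
      using step[OF Suc.prems] by (intro mult_left_mono) auto
    also have "\<dots> = exp (- real (Suc k)) * real (N (Suc k))"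
      by (simp add: exp_add[symmetric] mult.assoc[symmetric])
    finally show ?case .
  qed
  have fin: "finite (biregular V d)" using finite_biregular[OF V(1)] .
  have "{E \<in> biregular V d. E \<inter> I \<times> J = {}} = {E \<in> biregular V d. card (E \<inter> I \<times> J) = 0}"
    using biregular_finite[OF V(1)] by auto
  then have "real (card {E \<in> biregular V d. E \<inter> I \<times> J = {}}) = real (N 0)" unfolding N_def by simp
  also have "\<dots> \<le> exp (- real K) * real (N K)" using iter by simp
  also have "\<dots> \<le> exp (1 - \<mu> / 18) * real (card (biregular V d))"
    using K(2) fin unfolding N_def by (intro mult_mono) (auto intro!: card_mono)
  finally show ?thesis .
qed

section \<open>Binomial estimate and passage to digraphs\<close>

text \<open>The single term \<open>r^r / r!\<close> of the series for \<open>exp r\<close> is at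
  most its sum, so \<open>r!\<close> is at least \<open>(r / e)^r\<close>; this is inserted into the
  bound \<open>n^r / r!\<close> for the binomial coefficient.\<close>

lemma binomial_le_exp:
  assumes "0 < r" "r \<le> n"
  shows "real (n choose r) \<le> exp (real r * ln (exp 1 * real n / real r))"
proof -
  have "(\<Sum>k\<in>{r}. real r ^ k /\<^sub>R fact k) \<le> (\<Sum>k. real r ^ k /\<^sub>R fact k)"
    using exp_converges[of "real r"] by (intro sum_le_suminf) (auto simp: sums_iff)
  then have "real r ^ r / fact r \<le> exp (real r)"
    using exp_converges[of "real r"] by (simp add: sums_iff divide_inverse mult.commute)
  then have fact_ge: "real r ^ r \<le> exp (real r) * fact r"
    by (simp add: field_simps)
  have "real ((n choose r) * fact r) \<le> real (n ^ r)"
    using binomial_fact_pow by (simp only: of_nat_le_iff)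
  then have "real (n choose r) * fact r \<le> real n ^ r" by simp
  then have "real (n choose r) * fact r * exp (real r) \<le> real n ^ r * exp (real r)"
    by (rule mult_right_mono) simp
  moreover have "real (n choose r) * real r ^ r \<le> real (n choose r) * (exp (real r) * fact r)"
    using fact_ge by (rule mult_left_mono) simp
  ultimately have "real (n choose r) * real r ^ r \<le> real n ^ r * exp (real r)"
    by (simp only: mult_ac)
  then have "real (n choose r) \<le> (exp 1 * real n / real r) ^ r"
    using assms by (simp add: field_simps power_mult_distrib exp_of_nat_mult[symmetric] power_divide)
  also have "\<dots> = exp (ln (exp 1 * real n / real r)) ^ r"
    using assms by (subst exp_ln) auto
  also have "\<dots> = exp (real r * ln (exp 1 * real n / real r))"
    by (rule exp_of_nat_mult[symmetric])
  finally show ?thesis .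
qed

text \<open>With the vertex set fixed, a digraph without multiple arcs is determined by its arc
  relation, and its degrees are the sizes of relational images. All cardinality bounds thereby carry
  over.\<close>

lemma bij_betw_parcs: "bij_betw parcs (regular_digraphs n d) (biregular {1..n} d)"
proof -
  have arcs: "in_degree (with_proj G) v = card ((parcs G)\<inverse> `` {v})"
    "out_degree (with_proj G) v = card (parcs G `` {v})" for G :: "nat pair_pre_digraph" and v
  proof -
    have "in_arcs (with_proj G) v = (\<lambda>u. (u, v)) ` ((parcs G)\<inverse> `` {v})"
      "out_arcs (with_proj G) v = (\<lambda>u. (v, u)) ` (parcs G `` {v})"
      by (auto simp: in_arcs_def out_arcs_def)
    then show "in_degree (with_proj G) v = card ((parcs G)\<inverse> `` {v})"
      "out_degree (with_proj G) v = card (parcs G `` {v})"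
      unfolding in_degree_def out_degree_def by (simp_all add: card_image inj_on_def)
  qed
  show ?thesis
  proof (rule bij_betw_byWitness[where f' = "\<lambda>E. \<lparr>pverts = {1..n}, parcs = E\<rparr>"])
    show "parcs ` regular_digraphs n d \<subseteq> biregular {1..n} d"
    proof
      fix E assume "E \<in> parcs ` regular_digraphs n d"
      then obtain G where G: "E = parcs G" "pair_fin_digraph G" "pverts G = {1..n}"
        "\<forall>v\<in>{1..n}. in_degree (with_proj G) v = d \<and> out_degree (with_proj G) v = d"
        unfolding regular_digraphs_def by auto
      interpret pair_fin_digraph G by fact
      have "E \<subseteq> {1..n} \<times> {1..n}" using G(1,3) arc_fst_in_verts arc_snd_in_verts by auto
      then show "E \<in> biregular {1..n} d" using G unfolding biregular_def arcs by auto
    qed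
    show "(\<lambda>E. \<lparr>pverts = {1..n}, parcs = E\<rparr>) ` biregular {1..n} d \<subseteq> regular_digraphs n d"
    proof
      fix G assume "G \<in> (\<lambda>E. \<lparr>pverts = {1..n}, parcs = E\<rparr>) ` biregular {1..n} d"
      then obtain E where E: "G = \<lparr>pverts = {1..n}, parcs = E\<rparr>" "E \<in> biregular {1..n} d" by auto
      have "finite E" by (rule biregular_finite[OF _ E(2)]) simp
      then have "pair_fin_digraph G"
        using E by unfold_locales (auto simp: biregular_def)
      then show "G \<in> regular_digraphs n d"
        using E unfolding regular_digraphs_def arcs by (auto simp: biregular_def)
    qed
  qed (auto simp: regular_digraphs_def)
qed

section \<open>Union bound over pairs of vertex sets\<close>

theorem theorem2p6:
  shows "\<exists>c C C1 :: real. c > 0 \<and> C \<ge> 1 \<and> C1 \<ge> 1 \<and>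
    (\<forall>n d l r :: nat.
       n > 0 \<longrightarrow> d > 0 \<longrightarrow> l > 0 \<longrightarrow> r > 0 \<longrightarrow>
       C1 \<le> real d \<longrightarrow> real d \<le> real n / 24 \<longrightarrow>
       real r \<le> real n / 4 \<longrightarrow> l \<le> r \<longrightarrow>
       C * real n * ln (exp 1 * real n / real r) / real d \<le> real l \<longrightarrow>
       measure (uniform_count_measure (regular_digraphs n d))
         (\<Union>{no_edge_digraphs n d I J | I J.
              I \<subseteq> {1..n} \<and> J \<subseteq> {1..n} \<and> card I \<ge> l \<and> card J \<ge> r})
       \<le> exp (- (c * real r * real l * real d / real n)))"
\<comment> \<open>Half of the decay rate \<open>1 / 18\<close> is kept as \<open>c = 1 / 36\<close>.
  The other half must pay for two binomial coefficients, \<open>2 * t\<close>, and for the rounding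
  summand \<open>1 \<le> t\<close>; so \<open>3 * t \<le> \<mu> / 36\<close> is required, whence
  \<open>C = 3 * 36 = 108\<close>.\<close>
proof (rule exI[of _ "1 / 36"], rule exI[of _ 108], rule exI[of _ 1], intro conjI allI impI)
  fix n d l r :: nat
  assume n: "n > 0" and d: "d > 0" and l: "l > 0" and r: "r > 0"
    and dn: "real d \<le> real n / 24" and rn: "real r \<le> real n / 4" and lr: "l \<le> r"
    and l_ge: "108 * real n * ln (exp 1 * real n / real r) / real d \<le> real l"
  define \<mu> where "\<mu> = real l * real r * real d / real n"
  define t where "t = real r * ln (exp 1 * real n / real r)"
  let ?P = "\<lambda>m. {I. I \<subseteq> {1..n} \<and> card I = m}"
  let ?R = "regular_digraphs n d"
  let ?U = "\<Union>{no_edge_digraphs n d I J | I J.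
              I \<subseteq> {1..n} \<and> J \<subseteq> {1..n} \<and> card I \<ge> l \<and> card J \<ge> r}"
  let ?q = "exp (1 - \<mu> / 18) * real (card ?R)"
  have finR: "finite ?R"
    using bij_betw_finite[OF bij_betw_parcs] finite_biregular by blast
  have cardR: "card ?R = card (biregular {1..n} d)"
    using bij_betw_same_card[OF bij_betw_parcs] .
  have finP: "finite (?P m)" for m by (rule finite_subset[of _ "Pow {1..n}"]) auto
  have cardP: "card (?P m) = n choose m" for m using n_subsets[of "{1..n}" m] by simp
  have nat_le: "24 * d \<le> n" "4 * r \<le> n" using dn rn by linarith+

  have fixed: "real (card (no_edge_digraphs n d I J)) \<le> ?q" if "I \<in> ?P l" "J \<in> ?P r" for I J
  proof -
    have "parcs ` no_edge_digraphs n d I J \<subseteq> {E \<in> biregular {1..n} d. E \<inter> I \<times> J = {}}"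
      using bij_betw_imp_surj_on[OF bij_betw_parcs, of n d] by (auto simp: no_edge_digraphs_def)
    moreover have "inj_on parcs (no_edge_digraphs n d I J)"
      using bij_betw_imp_inj_on[OF bij_betw_parcs]
      by (rule inj_on_subset) (auto simp: no_edge_digraphs_def)
    ultimately have "card (no_edge_digraphs n d I J) \<le> card {E \<in> biregular {1..n} d. E \<inter> I \<times> J = {}}"
      by (intro card_inj_on_le[of parcs]) (auto simp: finite_biregular)
    also have "real \<dots> \<le> ?q"
      unfolding cardR \<mu>_def using that n d lr nat_le by (intro card_biregular_no_edge_le) auto
    finally show ?thesis by simp
  qed
  \<comment> \<open>Having no arcs from \<open>I\<close> to \<open>J\<close> is inherited by
    subsets, so the union reduces to sets of size exactly \<open>l\<close> and
    \<open>r\<close>.\<close>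
  have "?U \<subseteq> (\<Union>(I, J)\<in>?P l \<times> ?P r. no_edge_digraphs n d I J)"
  proof clarify
    fix G I J
    assume G: "G \<in> no_edge_digraphs n d I J" and sub: "I \<subseteq> {1..n}" "J \<subseteq> {1..n}"
      and c: "l \<le> card I" "r \<le> card J"
    obtain I' where "I' \<subseteq> I" "card I' = l" using obtain_subset_with_card_n[OF c(1)] by blast
    moreover obtain J' where "J' \<subseteq> J" "card J' = r" using obtain_subset_with_card_n[OF c(2)] by blast
    ultimately show "G \<in> (\<Union>(I, J)\<in>?P l \<times> ?P r. no_edge_digraphs n d I J)"
      using G sub by (intro UN_I[of "(I', J')"]) (auto simp: no_edge_digraphs_def subset_iff)
  qed
  moreover have "finite (no_edge_digraphs n d I J)" for I J
    using finR by (rule finite_subset[rotated]) (auto simp: no_edge_digraphs_def)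
  ultimately have "card ?U \<le> card (\<Union>(I, J)\<in>?P l \<times> ?P r. no_edge_digraphs n d I J)"
    using finP by (intro card_mono) auto
  also have "\<dots> \<le> (\<Sum>(I, J)\<in>?P l \<times> ?P r. card (no_edge_digraphs n d I J))"
    using card_UN_le[of "?P l \<times> ?P r" "\<lambda>(I, J). no_edge_digraphs n d I J"] finP
    by (simp add: case_prod_unfold)
  finally have "real (card ?U) \<le> (\<Sum>(I, J)\<in>?P l \<times> ?P r. real (card (no_edge_digraphs n d I J)))"
    unfolding of_nat_le_iff[where 'a = real, symmetric] by (simp add: case_prod_unfold)
  also have "\<dots> \<le> (\<Sum>(I, J)\<in>?P l \<times> ?P r. ?q)"
    using fixed by (intro sum_mono) auto
  also have "\<dots> = real (n choose l) * real (n choose r) * ?q"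
    by (simp add: case_prod_unfold card_cartesian_product cardP[simplified])
  also have "\<dots> \<le> exp t * exp t * ?q"
  proof -
    have "real (n choose r) \<le> exp t" unfolding t_def using r nat_le by (intro binomial_le_exp) auto
    \<comment> \<open>Binomial coefficients increase up to the middle and
      \<open>r \<le> n / 4\<close>, so the same \<open>t\<close> bounds both.\<close>
    moreover have "n choose l \<le> n choose r" using lr nat_le by (intro binomial_mono) auto
    ultimately show ?thesis by (intro mult_right_mono mult_mono) auto
  qed
  also have "\<dots> = exp (2 * t + 1 - \<mu> / 18) * real (card ?R)"
    by (simp add: exp_add[symmetric] mult.assoc[symmetric])
  also have "\<dots> \<le> exp (- (\<mu> / 36)) * real (card ?R)"
  proof -
    \<comment> \<open>The lower bound on \<open>l\<close>, multiplied by \<open>r * d / n\<close>,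
      turns into \<open>108 * t \<le> \<mu>\<close>.\<close>
    have "108 * t = 108 * real n * ln (exp 1 * real n / real r) / real d * (real r * real d / real n)"
      using n d unfolding t_def by simp
    also have "\<dots> \<le> real l * (real r * real d / real n)"
      using l_ge by (rule mult_right_mono) simp
    finally have "108 * t \<le> \<mu>" unfolding \<mu>_def by simp
    moreover have "t \<ge> 1"
    proof -
      have "ln (exp 1 * real n / real r) \<ge> ln (exp 1)"
        using r nat_le by (subst ln_le_cancel_iff) (auto simp: field_simps)
      then have "real r * ln (exp 1 * real n / real r) \<ge> 1 * 1"
        using r by (intro mult_mono) auto
      then show ?thesis unfolding t_def by simp
    qed
    ultimately show ?thesis by (intro mult_right_mono) auto
  qed
  finally have bound: "real (card ?U) \<le> exp (- (\<mu> / 36)) * real (card ?R)" .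
  have "?U \<subseteq> ?R" by (auto simp: no_edge_digraphs_def)
  then have "measure (uniform_count_measure ?R) ?U = real (card ?U) / real (card ?R)"
    by (rule measure_uniform_count_measure[OF finR])
  \<comment> \<open>If there were no regular digraph, the quotient would be
    \<open>0 / 0 = 0\<close>, so the existence of one need not be shown.\<close>
  also have "\<dots> \<le> exp (- (\<mu> / 36))"
    using bound by (cases "card ?R = 0") (simp_all add: divide_le_eq)
  also have "exp (- (\<mu> / 36)) = exp (- (1 / 36 * real r * real l * real d / real n))"
    unfolding \<mu>_def by (simp add: mult_ac)
  finally show "measure (uniform_count_measure ?R) ?U
      \<le> exp (- (1 / 36 * real r * real l * real d / real n))" .
qed auto

end
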